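(* Let $P$ and $Q$ be two MCCS terms. There is an execution $P\to^*Q$ if and only if the formula $\lceil P\rceil\multimap\lceil Q\rceil$ is provable in MLL (i.e. without modality rules) for some instantiation of the propositional variables of $\lceil P\rceil$.
   Context: MCCS terms are generated by $P,Q ::= 1 \mid P\parallel Q \mid a.P \mid \bar a.P$, with $a$ ranging over channel names. Structural congruence $\equiv$ is the smallest congruence making $\parallel$ associative and commutative with $1$ neutral. Execution $\to$ is the relation on terms up to $\equiv$ generated by $\bar a.P\parallel a.Q\parallel R\to P\parallel Q\parallel R$ (for arbitrary terms $P,Q,R$ and name $a$); $\to^*$ is its reflexive transitive closure (so $P\to^*Q$ holds in particular when $P\equiv Q$). MLLa formulas: $A,B ::= \alpha \mid \alpha^\perp \mid A\otimes B \mid A⅋B \mid \mathsf{M}^+_a A \mid \mathsf{M}^-_a A$ ($\alpha$ propositional variables, $a$ channel names), with negation $(\alpha)^\perp=\alpha^\perp$, $(\alpha^\perp)^\perp=\alpha$, $(A\otimes B)^\perp=A^\perp⅋B^\perp$, $(A⅋B)^\perp=A^\perp\otimes B^\perp$, $(\mathsf M^+_aA)^\perp=\mathsf M^-_a(A^\perp)$, $(\mathsf M^-_aA)^\perp=\mathsf M^+_a(A^\perp)$, and $A\multimap B := A^\perp⅋B$. "Provable in MLL" means derivable in the one-sided sequent calculus using only the rules axiom $\vdash A^\perp,A$ (for any formula $A$, possibly containing modalities), cut, $\otimes$ (from $\vdash\Gamma,A$ and $\vdash B,\Delta$ infer $\vdash\Gamma,A\otimes B,\Delta$) and $⅋$ (from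 $\vdash\Gamma,A,B$ infer $\vdash\Gamma,A⅋B$); the modality introduction rules are not allowed. An instantiation of propositional variables substitutes a formula $F_\alpha$ for each variable $\alpha$ (and $F_\alpha^\perp$ for $\alpha^\perp$). Synchronous translation: $\lceil 1\rceil = \alpha^\perp⅋\alpha$, $\lceil P\parallel Q\rceil = \lceil P\rceil\otimes\lceil Q\rceil$, $\lceil a.P\rceil = \mathsf{M}^+_a(\alpha^\perp⅋(\lceil P\rceil\otimes\alpha))$, $\lceil \bar a.P\rceil = \mathsf{M}^-_a(\lceil P\rceil\otimes\alpha^\perp)⅋\alpha$, where in each clause $\alpha$ is a fresh propositional variable (in particular the variables of $\lceil P\rceil$ and $\lceil Q\rceil$ are distinct).
   Formalization: Structural congruence is taken closed under parallel composition only, not under the prefixes a.P and ā.P; with closure under prefixes the claim fails, e.g. P = a.(1∥1), Q = a.1 are congruent but no instance of ⌈P⌉⊸⌈Q⌉ is provable in MLL. *)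

theory Defs
  imports Main "HOL-Library.Multiset"
begin

datatype 'c mccs =
    One
  | Par "'c mccs" "'c mccs" (infixr "\<parallel>" 65)
  | Act 'c "'c mccs"
  | CoAct 'c "'c mccs"

(* The least congruence of the algebra (terms, \<parallel>, One) for which the quotient is a
   commutative monoid. It relates prefixed terms only when they are equal: rearranging the
   continuation P of a term Act a P is not part of the relation, because in MLL without modality
   rules the formula translating P is hidden below a modality. (With closure under prefixes,
   Act a (One \<parallel> One) and Act a One would be identified, yet no instance of the linear
   implication between their translations is provable in MLL.) *)
inductive struct_cong :: "'c mccs \<Rightarrow> 'c mccs \<Rightarrow> bool" (infix "\<equiv>\<^sub>s" 50) where
  cong_refl: "P \<equiv>\<^sub>s P"
| cong_sym: "P \<equiv>\<^sub>s Q \<Longrightarrow> Q \<equiv>\<^sub>s P"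
| cong_trans: "P \<equiv>\<^sub>s Q \<Longrightarrow> Q \<equiv>\<^sub>s R \<Longrightarrow> P \<equiv>\<^sub>s R"
| cong_par: "P \<equiv>\<^sub>s P' \<Longrightarrow> Q \<equiv>\<^sub>s Q' \<Longrightarrow> P \<parallel> Q \<equiv>\<^sub>s P' \<parallel> Q'"
| cong_assoc: "(P \<parallel> Q) \<parallel> R \<equiv>\<^sub>s P \<parallel> (Q \<parallel> R)"
| cong_comm: "P \<parallel> Q \<equiv>\<^sub>s Q \<parallel> P"
| cong_unit: "P \<parallel> One \<equiv>\<^sub>s P"

inductive step :: "'c mccs \<Rightarrow> 'c mccs \<Rightarrow> bool" (infix "\<leadsto>" 50) where
  "S \<equiv>\<^sub>s CoAct a P \<parallel> Act a Q \<parallel> R \<Longrightarrow> S' \<equiv>\<^sub>s P \<parallel> Q \<parallel> R \<Longrightarrow> S \<leadsto> S'"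

(* The reflexive transitive closure of execution on terms up to structural congruence. *)
definition exec :: "'c mccs \<Rightarrow> 'c mccs \<Rightarrow> bool" (infix "\<leadsto>*" 50) where
  "exec = (\<lambda>P Q. P \<equiv>\<^sub>s Q \<or> P \<leadsto> Q)\<^sup>*\<^sup>*"

datatype 'c formula =
    Var nat
  | NVar nat
  | Tensor "'c formula" "'c formula"
  | Parr "'c formula" "'c formula"
  | MPos 'c "'c formula"
  | MNeg 'c "'c formula"

primrec neg :: "'c formula \<Rightarrow> 'c formula" where
  "neg (Var x) = NVar x"
| "neg (NVar x) = Var x"
| "neg (Tensor A B) = Parr (neg A) (neg B)"
| "neg (Parr A B) = Tensor (neg A) (neg B)"
| "neg (MPos a A) = MNeg a (neg A)"
| "neg (MNeg a A) = MPos a (neg A)"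

definition limp :: "'c formula \<Rightarrow> 'c formula \<Rightarrow> 'c formula" (infixr "\<multimap>" 60) where
  "A \<multimap> B = Parr (neg A) B"

primrec vars :: "'c formula \<Rightarrow> nat set" where
  "vars (Var x) = {x}"
| "vars (NVar x) = {x}"
| "vars (Tensor A B) = vars A \<union> vars B"
| "vars (Parr A B) = vars A \<union> vars B"
| "vars (MPos a A) = vars A"
| "vars (MNeg a A) = vars A"

primrec inst :: "(nat \<Rightarrow> 'c formula) \<Rightarrow> 'c formula \<Rightarrow> 'c formula" where
  "inst F (Var x) = F x"
| "inst F (NVar x) = neg (F x)"
| "inst F (Tensor A B) = Tensor (inst F A) (inst F B)"
| "inst F (Parr A B) = Parr (inst F A) (inst F B)"
| "inst F (MPos a A) = MPos a (inst F A)"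
| "inst F (MNeg a A) = MNeg a (inst F A)"

(* Sequents are multisets, so exchange is implicit. There is no rule for the modalities. *)
inductive mll :: "'c formula multiset \<Rightarrow> bool" where
  mll_ax: "mll {#neg A, A#}"
| mll_cut: "mll (add_mset A \<Gamma>) \<Longrightarrow> mll (add_mset (neg A) \<Delta>) \<Longrightarrow> mll (\<Gamma> + \<Delta>)"
| mll_tensor: "mll (add_mset A \<Gamma>) \<Longrightarrow> mll (add_mset B \<Delta>) \<Longrightarrow> mll (add_mset (Tensor A B) (\<Gamma> + \<Delta>))"
| mll_parr: "mll (add_mset A (add_mset B \<Gamma>)) \<Longrightarrow> mll (add_mset (Parr A B) \<Gamma>)"

(* The synchronous translation is determined up to the choice of its fresh variables, hence a
   relation: "translates P A" says that A is a translation of P for some choice of them. *)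
inductive translates :: "'c mccs \<Rightarrow> 'c formula \<Rightarrow> bool" where
  tr_One: "translates One (Parr (NVar x) (Var x))"
| tr_Par: "translates P A \<Longrightarrow> translates Q B \<Longrightarrow> vars A \<inter> vars B = {} \<Longrightarrow>
     translates (P \<parallel> Q) (Tensor A B)"
| tr_Act: "translates P A \<Longrightarrow> x \<notin> vars A \<Longrightarrow>
     translates (Act a P) (MPos a (Parr (NVar x) (Tensor A (Var x))))"
| tr_CoAct: "translates P A \<Longrightarrow> x \<notin> vars A \<Longrightarrow>
     translates (CoAct a P) (Parr (MNeg a (Tensor A (NVar x))) (Var x))"

lemma finite_vars: "finite (vars A)"
  by (induction A) auto

lemma ex_translates_avoiding: "finite X \<Longrightarrow> \<exists>A. translates P A \<and> vars A \<inter> X = {}"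
proof (induction P arbitrary: X)
  case One
  then obtain x where "x \<notin> X" using ex_new_if_finite[OF infinite_UNIV_nat] by blast
  then have "vars (Parr (NVar x) (Var x) :: 'a formula) \<inter> X = {}" by simp
  then show ?case using tr_One by blast
next
  case (Par P Q)
  obtain A where A: "translates P A" "vars A \<inter> X = {}" using Par by blast
  have "finite (X \<union> vars A)" using Par.prems finite_vars by blast
  then obtain B where B: "translates Q B" "vars B \<inter> (X \<union> vars A) = {}" using Par.IH(2) by blast
  have "translates (P \<parallel> Q) (Tensor A B)" using A B by (intro tr_Par) auto
  moreover have "vars (Tensor A B) \<inter> X = {}" using A B by auto
  ultimately show ?case by blast
next
  case (Act a P)
  obtain A where A: "translates P A" "vars A \<inter> X = {}" using Act by blast
  have "finite (X \<union> vars A)" using Act.prems finite_vars by blast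
  then obtain x where x: "x \<notin> X \<union> vars A" using ex_new_if_finite[OF infinite_UNIV_nat] by blast
  have "translates (Act a P) (MPos a (Parr (NVar x) (Tensor A (Var x))))"
    using A x by (intro tr_Act) auto
  moreover have "vars (MPos a (Parr (NVar x) (Tensor A (Var x)))) \<inter> X = {}" using A x by auto
  ultimately show ?case by blast
next
  case (CoAct a P)
  obtain A where A: "translates P A" "vars A \<inter> X = {}" using CoAct by blast
  have "finite (X \<union> vars A)" using CoAct.prems finite_vars by blast
  then obtain x where x: "x \<notin> X \<union> vars A" using ex_new_if_finite[OF infinite_UNIV_nat] by blast
  have "translates (CoAct a P) (Parr (MNeg a (Tensor A (NVar x))) (Var x))"
    using A x by (intro tr_CoAct) auto
  moreover have "vars (Parr (MNeg a (Tensor A (NVar x))) (Var x)) \<inter> X = {}" using A x by auto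
  ultimately show ?case by blast
qed

end

theory Submission
  imports Defs
begin

text \<open>
  Without their introduction rules, modal formulas behave in MLL as atoms. If an instance of
  \<open>\<lceil>P\<rceil>\<close> entails \<open>\<lceil>Q\<rceil>\<close>, then every atom has the same signed number of occurrences in both
  formulas, and this balance alone forces an execution: an input \<open>a.P'\<close> of \<open>P\<close> contributes a single
  positive atom, while an output contributes a negative atom and an arbitrary formula that is smaller
  than this atom. Hence the largest of the negative atoms contributed by \<open>P\<close> can only be
  compensated by an input of \<open>P\<close>, which allows a reaction that preserves the balance, or by an
  identical output of \<open>Q\<close>, which can be cancelled.
\<close>

section \<open>Instances of translations\<close>

lemma neg_neg [simp]: "neg (neg A) = A"
  by (induction A) auto

lemma neg_inject [simp]: "neg A = neg B \<longleftrightarrow> A = B"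
  by (metis neg_neg)

lemma size_neg [simp]: "size (neg A) = size A"
  by (induction A) auto

lemma inst_neg: "inst F (neg A) = neg (inst F A)"
  by (induction A) auto

lemma inst_cong: "(\<And>x. x \<in> vars A \<Longrightarrow> F x = G x) \<Longrightarrow> inst F A = inst G A"
  by (induction A) auto

lemma inst_Var [simp]: "inst Var A = A"
  by (induction A) auto

text \<open>The instances of the translations of a process whose fresh variables are replaced by
  formulas in \<open>U\<close>.\<close>

inductive realizes :: "'c formula set \<Rightarrow> 'c mccs \<Rightarrow> 'c formula \<Rightarrow> bool" for U where
  realizes_One: "G \<in> U \<Longrightarrow> realizes U One (Parr (neg G) G)"
| realizes_Par: "realizes U P X \<Longrightarrow> realizes U Q Y \<Longrightarrow> realizes U (P \<parallel> Q) (Tensor X Y)"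
| realizes_Act: "realizes U P X \<Longrightarrow> G \<in> U \<Longrightarrow>
    realizes U (Act a P) (MPos a (Parr (neg G) (Tensor X G)))"
| realizes_CoAct: "realizes U P X \<Longrightarrow> G \<in> U \<Longrightarrow>
    realizes U (CoAct a P) (Parr (MNeg a (Tensor X (neg G))) G)"

inductive_cases realizes_OneE: "realizes U One X"
inductive_cases realizes_ParE: "realizes U (P \<parallel> Q) X"
inductive_cases realizes_ActE: "realizes U (Act a P) X"
inductive_cases realizes_CoActE: "realizes U (CoAct a P) X"

lemma translates_imp_realizes:
  "translates P A \<Longrightarrow> (\<And>x. F x \<in> U) \<Longrightarrow> realizes U P (inst F A)"
  by (induction rule: translates.induct) (auto intro: realizes.intros)

text \<open>Freshness makes the instantiations found for the components compatible: they concern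
  disjoint sets of variables, so they can be glued into one.\<close>

lemma realizes_imp_inst:
  "realizes U P X \<Longrightarrow> translates P A \<Longrightarrow> \<exists>F. inst F A = X"
proof (induction arbitrary: A rule: realizes.induct)
  case (realizes_One G)
  then obtain x where "A = Parr (NVar x) (Var x)" by (auto elim: translates.cases)
  then have "inst (\<lambda>_. G) A = Parr (neg G) G" by simp
  then show ?case by blast
next
  case (realizes_Par P X Q Y)
  from realizes_Par.prems obtain A1 A2 where A: "A = Tensor A1 A2"
    "translates P A1" "translates Q A2" "vars A1 \<inter> vars A2 = {}"
    by (auto elim: translates.cases)
  obtain F1 F2 where F: "inst F1 A1 = X" "inst F2 A2 = Y"
    using realizes_Par.IH A by blast
  let ?F = "\<lambda>x. if x \<in> vars A1 then F1 x else F2 x"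
  have "inst ?F A1 = X" "inst ?F A2 = Y"
    unfolding F[symmetric] using A(4) by (auto intro!: inst_cong)
  then have "inst ?F A = Tensor X Y" using A(1) by simp
  then show ?case by blast
next
  case (realizes_Act P X G a)
  from realizes_Act.prems obtain A1 x where A: "translates P A1" "x \<notin> vars A1"
    "A = MPos a (Parr (NVar x) (Tensor A1 (Var x)))"
    by (auto elim: translates.cases)
  obtain F where F: "inst F A1 = X" using realizes_Act.IH A by blast
  have "inst (F(x := G)) A1 = X"
    unfolding F[symmetric] using A(2) by (auto intro!: inst_cong)
  then have "inst (F(x := G)) A = MPos a (Parr (neg G) (Tensor X G))" using A(3) by simp
  then show ?case by blast
next
  case (realizes_CoAct P X G a)
  from realizes_CoAct.prems obtain A1 x where A: "translates P A1" "x \<notin> vars A1"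
    "A = Parr (MNeg a (Tensor A1 (NVar x))) (Var x)"
    by (auto elim: translates.cases)
  obtain F where F: "inst F A1 = X" using realizes_CoAct.IH A by blast
  have "inst (F(x := G)) A1 = X"
    unfolding F[symmetric] using A(2) by (auto intro!: inst_cong)
  then have "inst (F(x := G)) A = Parr (MNeg a (Tensor X (neg G))) G" using A(3) by simp
  then show ?case by blast
qed

text \<open>\<open>One\<close> and outputs are the only two process forms whose formulas share the
  outermost connective. Equality would force \<open>G = H\<close>, and then \<open>neg H\<close>
  would be a proper subformula of itself.\<close>

lemma One_CoAct_formulas_distinct:
  "Parr (neg G) G \<noteq> Parr (MNeg a (Tensor X (neg H))) H"
proof
  assume "Parr (neg G) G = Parr (MNeg a (Tensor X (neg H))) H"
  then have "neg H = MNeg a (Tensor X (neg H))" by auto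
  then have "size (neg H) = size (MNeg a (Tensor X (neg H)))" by (rule arg_cong)
  then show False by simp
qed

text \<open>The process can be read off any instance of its translation. This identifies a source
  thread with a target thread once their formulas agree, although the two may be instantiated from
  different sets.\<close>

lemma realizes_inject: "realizes U P X \<Longrightarrow> realizes V Q X \<Longrightarrow> P = Q"
proof (induction arbitrary: Q rule: realizes.induct)
  case (realizes_One G)
  from realizes_One.prems show ?case
    by cases (use One_CoAct_formulas_distinct in auto)
next
  case (realizes_Par P X Q' Y)
  from realizes_Par.prems show ?case by cases (use realizes_Par.IH in auto)
next
  case (realizes_Act P X G a)
  from realizes_Act.prems show ?case by cases (use realizes_Act.IH in auto)
next
  case (realizes_CoAct P X G a)
  from realizes_CoAct.prems show ?case
  proof cases
    case realizes_One
    then show ?thesis by (metis One_CoAct_formulas_distinct)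
  qed (use realizes_CoAct.IH in auto)
qed

section \<open>From executions to proofs\<close>

definition entails :: "'c formula \<Rightarrow> 'c formula \<Rightarrow> bool" where
  "entails X Y \<longleftrightarrow> mll {#neg X, Y#}"

section \<open>Derived entailments of the multiplicatives\<close>

lemma entails_refl: "entails X X"
  unfolding entails_def by (rule mll_ax)

lemma entails_trans: "entails X Y \<Longrightarrow> entails Y Z \<Longrightarrow> entails X Z"
  unfolding entails_def using mll_cut[of Y "{#neg X#}" "{#Z#}"]
  by (simp add: add_mset_commute)

lemma entails_Tensor:
  assumes "entails X X'" "entails Y Y'"
  shows "entails (Tensor X Y) (Tensor X' Y')"
proof -
  have "mll {#Tensor X' Y', neg X, neg Y#}"
    using mll_tensor[of X' "{#neg X#}" Y' "{#neg Y#}"] assms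
    by (simp add: entails_def add_mset_commute)
  then show ?thesis
    using mll_parr[of "neg X" "neg Y" "{#Tensor X' Y'#}"]
    by (simp add: entails_def add_mset_commute)
qed

lemma entails_Tensor_comm: "entails (Tensor X Y) (Tensor Y X)"
proof -
  have "mll {#Tensor Y X, neg Y, neg X#}"
    using mll_tensor[of Y "{#neg Y#}" X "{#neg X#}"] mll_ax[of X] mll_ax[of Y]
    by (simp add: add_mset_commute)
  then show ?thesis
    using mll_parr[of "neg X" "neg Y" "{#Tensor Y X#}"]
    by (simp add: entails_def add_mset_commute)
qed

lemma entails_Tensor_assoc: "entails (Tensor (Tensor X Y) Z) (Tensor X (Tensor Y Z))"
proof -
  have "mll {#Tensor Y Z, neg Y, neg Z#}"
    using mll_tensor[of Y "{#neg Y#}" Z "{#neg Z#}"] mll_ax[of Y] mll_ax[of Z]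
    by (simp add: add_mset_commute)
  then have "mll {#neg X, neg Y, Tensor X (Tensor Y Z), neg Z#}"
    using mll_tensor[of X "{#neg X#}" "Tensor Y Z" "{#neg Y, neg Z#}"] mll_ax[of X]
    by (simp add: add_mset_commute)
  from mll_parr[OF this] have "mll {#Parr (neg X) (neg Y), neg Z, Tensor X (Tensor Y Z)#}"
    by (simp add: add_mset_commute)
  from mll_parr[OF this] show ?thesis by (simp add: entails_def)
qed

lemma entails_Tensor_assoc': "entails (Tensor X (Tensor Y Z)) (Tensor (Tensor X Y) Z)"
  by (meson entails_Tensor entails_Tensor_assoc entails_Tensor_comm entails_refl entails_trans)

lemma entails_Tensor_unit: "entails X (Tensor X (Parr (neg G) G))"
  using mll_tensor[of X "{#neg X#}" "Parr (neg G) G" "{#}"] mll_parr[of "neg G" G "{#}"]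
    mll_ax[of X] mll_ax[of G]
  by (simp add: entails_def add_mset_commute)

text \<open>Modus ponens: \<open>Parr (neg X) Y\<close> is the linear implication from
  \<open>X\<close> to \<open>Y\<close>.\<close>

lemma entails_apply: "entails (Tensor X (Parr (neg X) Y)) Y"
proof -
  have "mll {#neg X, Tensor X (neg Y), Y#}"
    using mll_tensor[of X "{#neg X#}" "neg Y" "{#Y#}"] mll_ax[of X] mll_ax[of Y]
    by (simp add: add_mset_commute)
  from mll_parr[OF this] show ?thesis by (simp add: entails_def)
qed

text \<open>The target instance is given and the source instance is chosen to fit it. Instantiations
  are thus built backwards along an execution, which makes the relation compose.\<close>

definition simulates :: "'c mccs \<Rightarrow> 'c mccs \<Rightarrow> bool" where
  "simulates P Q \<longleftrightarrow>
    (\<forall>Y. realizes UNIV Q Y \<longrightarrow> (\<exists>X. realizes UNIV P X \<and> entails X Y))"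

lemma simulates_refl: "simulates P P"
  unfolding simulates_def using entails_refl by blast

lemma simulates_trans: "simulates P Q \<Longrightarrow> simulates Q R \<Longrightarrow> simulates P R"
  unfolding simulates_def using entails_trans by blast

lemma struct_cong_simulates: "P \<equiv>\<^sub>s Q \<Longrightarrow> simulates P Q \<and> simulates Q P"
proof (induction rule: struct_cong.induct)
  case (cong_refl P)
  then show ?case by (simp add: simulates_refl)
next
  case (cong_trans P Q R)
  then show ?case using simulates_trans by blast
next
  case (cong_par P P' Q Q')
  then show ?case
    unfolding simulates_def by (fastforce elim!: realizes_ParE intro: realizes_Par entails_Tensor)
next
  case (cong_assoc P Q R)
  then show ?case
    unfolding simulates_def
    by (fastforce elim!: realizes_ParE
        intro: realizes_Par entails_Tensor_assoc entails_Tensor_assoc')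
next
  case (cong_comm P Q)
  then show ?case
    unfolding simulates_def
    by (fastforce elim!: realizes_ParE intro: realizes_Par entails_Tensor_comm)
next
  case (cong_unit P)
  have "simulates (P \<parallel> One) P"
    unfolding simulates_def
  proof (intro allI impI exI conjI)
    fix Y assume "realizes UNIV P Y"
    \<comment> \<open>The variable of \<open>One\<close> is instantiated with \<open>Y\<close>
      itself, so that the formula of \<open>One\<close> becomes the implication from
      \<open>Y\<close> to \<open>Y\<close> and can be applied to \<open>Y\<close>.\<close>
    then show "realizes UNIV (P \<parallel> One) (Tensor Y (Parr (neg Y) Y))"
      by (intro realizes_Par realizes_One) simp_all
    show "entails (Tensor Y (Parr (neg Y) Y)) Y" by (rule entails_apply)
  qed
  moreover have "simulates P (P \<parallel> One)"
    unfolding simulates_def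
    by (auto elim!: realizes_ParE realizes_OneE intro: entails_Tensor_unit)
  ultimately show ?case by simp
qed simp

lemma reaction_simulates: "simulates (CoAct a P \<parallel> Act a Q \<parallel> R) (P \<parallel> Q \<parallel> R)"
  unfolding simulates_def
proof (intro allI impI)
  fix W assume "realizes UNIV (P \<parallel> Q \<parallel> R) W"
  then obtain X Y Z where W: "W = Tensor X (Tensor Y Z)"
    and r: "realizes UNIV P X" "realizes UNIV Q Y" "realizes UNIV R Z"
    by (auto elim!: realizes_ParE)
  \<comment> \<open>Instantiating the input's variable with \<open>X\<close> and the output's with
    \<open>?G\<close> makes the two modal formulas dual. The output then reads as an implication
    from the input's formula \<open>neg ?K\<close> to \<open>?G\<close>, the tensor of both
    continuations.\<close>
  let ?G = "Tensor Y X"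
  let ?K = "MNeg a (Tensor X (neg ?G))"
  have K: "neg ?K = MPos a (Parr (neg X) ?G)" by simp
  have "realizes UNIV (CoAct a P \<parallel> Act a Q \<parallel> R) (Tensor (Parr ?K ?G) (Tensor (neg ?K) Z))"
    unfolding K using r by (intro realizes_Par realizes_Act realizes_CoAct) simp_all
  moreover have "entails (Tensor (Parr ?K ?G) (Tensor (neg ?K) Z)) W"
  proof -
    have "entails (Tensor (neg ?K) (Parr ?K ?G)) ?G"
      using entails_apply[of "neg ?K" ?G] unfolding neg_neg .
    then have "entails (Tensor (Tensor (neg ?K) (Parr ?K ?G)) Z) (Tensor (Tensor X Y) Z)"
      by (meson entails_Tensor entails_Tensor_comm entails_refl entails_trans)
    moreover have "entails (Tensor (Parr ?K ?G) (Tensor (neg ?K) Z))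
        (Tensor (Tensor (neg ?K) (Parr ?K ?G)) Z)"
      by (meson entails_Tensor entails_Tensor_assoc' entails_Tensor_comm entails_refl
          entails_trans)
    ultimately show ?thesis
      unfolding W by (meson entails_Tensor_assoc entails_trans)
  qed
  ultimately show "\<exists>V. realizes UNIV (CoAct a P \<parallel> Act a Q \<parallel> R) V \<and> entails V W" by blast
qed

lemma exec_simulates:
  assumes "P \<leadsto>* Q"
  shows "simulates P Q"
  using assms unfolding exec_def
proof (induction rule: rtranclp_induct)
  case base
  show ?case by (rule simulates_refl)
next
  case (step Q R)
  from step.hyps(2) have "simulates Q R"
    by (auto elim!: step.cases)
      (meson struct_cong_simulates reaction_simulates simulates_trans)+
  with step.IH show ?case by (rule simulates_trans)
qed

section \<open>Processes as multisets of threads\<close>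

text \<open>A normal form: processes with the same threads are structurally congruent. It stops at
  prefixes, as the congruence does.\<close>

primrec threads :: "'c mccs \<Rightarrow> 'c mccs multiset" where
  "threads One = {#}"
| "threads (P \<parallel> Q) = threads P + threads Q"
| "threads (Act a P) = {#Act a P#}"
| "threads (CoAct a P) = {#CoAct a P#}"

abbreviation par_list :: "'c mccs list \<Rightarrow> 'c mccs" where
  "par_list Ps \<equiv> foldr (\<parallel>) Ps One"

declare cong_trans [trans]

lemma struct_cong_One_Par: "One \<parallel> P \<equiv>\<^sub>s P"
  using cong_comm cong_unit cong_trans by blast

lemma par_list_append: "par_list (xs @ ys) \<equiv>\<^sub>s par_list xs \<parallel> par_list ys"
proof (induction xs)
  case Nil
  show ?case using cong_sym[OF struct_cong_One_Par] by simp
next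
  case (Cons P xs)
  have "P \<parallel> par_list (xs @ ys) \<equiv>\<^sub>s P \<parallel> (par_list xs \<parallel> par_list ys)"
    using Cons.IH by (intro cong_par cong_refl)
  also have "P \<parallel> (par_list xs \<parallel> par_list ys) \<equiv>\<^sub>s (P \<parallel> par_list xs) \<parallel> par_list ys"
    by (rule cong_sym[OF cong_assoc])
  finally show ?case by simp
qed

lemma par_list_mset_cong: "mset xs = mset ys \<Longrightarrow> par_list xs \<equiv>\<^sub>s par_list ys"
proof (induction xs arbitrary: ys)
  case Nil
  then show ?case by (simp add: cong_refl)
next
  case (Cons P xs)
  then have "P \<in> set ys" by (metis list.set_intros(1) set_mset_mset)
  then obtain us vs where ys: "ys = us @ P # vs" by (meson split_list)
  have "par_list ys \<equiv>\<^sub>s par_list us \<parallel> (P \<parallel> par_list vs)"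
    using par_list_append[of us "P # vs"] ys by simp
  also have "par_list us \<parallel> (P \<parallel> par_list vs) \<equiv>\<^sub>s (P \<parallel> par_list vs) \<parallel> par_list us"
    by (rule cong_comm)
  also have "(P \<parallel> par_list vs) \<parallel> par_list us \<equiv>\<^sub>s P \<parallel> (par_list vs \<parallel> par_list us)"
    by (rule cong_assoc)
  also have "P \<parallel> (par_list vs \<parallel> par_list us) \<equiv>\<^sub>s P \<parallel> par_list xs"
  proof (intro cong_par cong_refl)
    have "mset xs = mset (vs @ us)" using Cons.prems ys by simp
    then show "par_list vs \<parallel> par_list us \<equiv>\<^sub>s par_list xs"
      using Cons.IH[of "vs @ us"] par_list_append[of vs us] cong_sym cong_trans by blast
  qed
  finally show ?case using cong_sym by simp
qed

lemma struct_cong_par_list: "threads P = mset xs \<Longrightarrow> P \<equiv>\<^sub>s par_list xs"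
proof (induction P arbitrary: xs)
  case One
  then show ?case by (simp add: cong_refl)
next
  case (Par P Q)
  obtain ys zs where yz: "threads P = mset ys" "threads Q = mset zs"
    by (metis ex_mset)
  have "P \<parallel> Q \<equiv>\<^sub>s par_list ys \<parallel> par_list zs"
    using Par.IH yz by (intro cong_par) auto
  also have "par_list ys \<parallel> par_list zs \<equiv>\<^sub>s par_list (ys @ zs)"
    by (rule cong_sym[OF par_list_append])
  also have "par_list (ys @ zs) \<equiv>\<^sub>s par_list xs"
    using Par.prems yz by (intro par_list_mset_cong) simp
  finally show ?case .
qed (use cong_unit cong_sym in force)+

lemma threads_eq_imp_struct_cong: "threads P = threads Q \<Longrightarrow> P \<equiv>\<^sub>s Q"
  by (metis ex_mset struct_cong_par_list cong_sym cong_trans)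

lemma threads_of_thread: "S \<in># threads P \<Longrightarrow> threads S = {#S#}"
  by (induction P) auto

lemma threads_par_list: "(\<And>S. S \<in> set xs \<Longrightarrow> threads S = {#S#}) \<Longrightarrow> threads (par_list xs) = mset xs"
  by (induction xs) auto

text \<open>The hypothesis says that all elements are prefixed processes; composing them in parallel
  in any order gives a witness.\<close>

lemma ex_threads:
  assumes "\<And>S. S \<in># T \<Longrightarrow> threads S = {#S#}"
  shows "\<exists>P. threads P = T"
  by (metis assms ex_mset set_mset_mset threads_par_list)

text \<open>Execution on normal forms, where structural congruence has disappeared into equality of
  multisets.\<close>

inductive reacts :: "'c mccs multiset \<Rightarrow> 'c mccs multiset \<Rightarrow> bool" where
  "reacts (add_mset (CoAct a P) (add_mset (Act a Q) T)) (threads P + threads Q + T)"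

lemma reacts_imp_step:
  assumes "reacts (threads P) T"
  shows "\<exists>Q. threads Q = T \<and> P \<leadsto> Q"
  using assms
proof cases
  case (1 a P1 P2 T')
  have "\<exists>R. threads R = T'"
    using 1(1) by (intro ex_threads, intro threads_of_thread[of _ P]) auto
  then obtain R where R: "threads R = T'" by blast
  have "P \<equiv>\<^sub>s CoAct a P1 \<parallel> Act a P2 \<parallel> R"
    using 1(1) R by (intro threads_eq_imp_struct_cong) auto
  then have "P \<leadsto> P1 \<parallel> P2 \<parallel> R"
    using cong_refl by (rule step.intros)
  moreover have "threads (P1 \<parallel> P2 \<parallel> R) = T" using 1(2) R by simp
  ultimately show ?thesis by blast
qed

lemma reacts_star_imp_exec:
  assumes "reacts\<^sup>*\<^sup>* (threads P) T" "T = threads Q"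
  shows "P \<leadsto>* Q"
proof -
  have "\<exists>R. threads R = T \<and> P \<leadsto>* R"
    using assms(1)
  proof (induction rule: rtranclp_induct)
    case base
    have "P \<leadsto>* P" unfolding exec_def by simp
    then show ?case by blast
  next
    case (step T T')
    then obtain R where R: "threads R = T" "P \<leadsto>* R" by blast
    obtain R' where "threads R' = T'" "R \<leadsto> R'"
      using step.hyps(2) R(1) reacts_imp_step by blast
    moreover have "P \<leadsto>* R'"
      using R(2) \<open>R \<leadsto> R'\<close> unfolding exec_def by (auto intro: rtranclp.rtrancl_into_rtrancl)
    ultimately show ?case by blast
  qed
  then obtain R where R: "threads R = threads Q" "P \<leadsto>* R" using assms(2) by blast
  \<comment> \<open>The execution reaches \<open>R\<close>, which is only congruent to
    \<open>Q\<close>; the last congruence is absorbed as one more step of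
    \<open>exec\<close>.\<close>
  then show ?thesis
    using threads_eq_imp_struct_cong[OF R(1)] unfolding exec_def
    by (auto intro: rtranclp.rtrancl_into_rtrancl)
qed

lemma reacts_add_mset: "reacts T T' \<Longrightarrow> reacts (add_mset S T) (add_mset S T')"
proof (induction rule: reacts.induct)
  case (1 a P Q T)
  show ?case
    using reacts.intros[of a P Q "add_mset S T"] by (simp add: add_mset_commute)
qed

lemma reacts_star_add_mset: "reacts\<^sup>*\<^sup>* T T' \<Longrightarrow> reacts\<^sup>*\<^sup>* (add_mset S T) (add_mset S T')"
  by (induction rule: rtranclp_induct) (auto intro: rtranclp.rtrancl_into_rtrancl reacts_add_mset)

section \<open>The balance of atoms\<close>

text \<open>The signed number of occurrences of the atom \<open>Z\<close> outside modalities, where \<open>Z\<close> is a variable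
  or of the form \<open>MPos a A\<close>; \<open>MNeg a A\<close> is a negative occurrence of \<open>MPos a (neg A)\<close>.\<close>

primrec balance :: "'c formula \<Rightarrow> 'c formula \<Rightarrow> int" where
  "balance Z (Var x) = of_bool (Z = Var x)"
| "balance Z (NVar x) = - of_bool (Z = Var x)"
| "balance Z (Tensor A B) = balance Z A + balance Z B"
| "balance Z (Parr A B) = balance Z A + balance Z B"
| "balance Z (MPos a A) = of_bool (Z = MPos a A)"
| "balance Z (MNeg a A) = - of_bool (Z = MPos a (neg A))"

lemma balance_neg [simp]: "balance Z (neg A) = - balance Z A"
  by (induction A) auto

text \<open>Negation flips the sign, so axioms sum to zero and cut formulas cancel; both connectives
  add balances. This is all that the converse direction uses about provability.\<close>

lemma mll_balance: "mll \<Gamma> \<Longrightarrow> (\<Sum>A\<in>#\<Gamma>. balance Z A) = 0"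
  by (induction rule: mll.induct) auto

text \<open>A formula is at least as large as each atom occurring in it.\<close>

lemma balance_eq_0: "size A < size Z \<Longrightarrow> balance Z A = 0"
  by (induction A) auto

text \<open>Each thread is paired with its instance; \<open>threads S = {#S#}\<close> expresses that
  \<open>S\<close> starts with a prefix.\<close>

definition realized_threads :: "'c formula set \<Rightarrow> ('c mccs \<times> 'c formula) multiset \<Rightarrow> bool" where
  "realized_threads U M \<longleftrightarrow> (\<forall>(S, X)\<in>#M. realizes U S X \<and> threads S = {#S#})"

abbreviation total_balance :: "'c formula \<Rightarrow> ('c mccs \<times> 'c formula) multiset \<Rightarrow> int" where
  "total_balance Z M \<equiv> \<Sum>p\<in>#M. balance Z (snd p)"

abbreviation total_size :: "('c mccs \<times> 'c formula) multiset \<Rightarrow> nat" where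
  "total_size M \<equiv> \<Sum>p\<in>#M. size (fst p)"

lemma realized_threads_add_mset [simp]:
  "realized_threads U (add_mset (S, X) M) \<longleftrightarrow>
    realizes U S X \<and> threads S = {#S#} \<and> realized_threads U M"
  by (simp add: realized_threads_def)

lemma realized_threads_union [simp]:
  "realized_threads U (M + N) \<longleftrightarrow> realized_threads U M \<and> realized_threads U N"
  by (auto simp: realized_threads_def)

lemma realized_threads_cases:
  assumes "realized_threads U M" "p \<in># M"
  obtains (Act) a P X G where "p = (Act a P, MPos a (Parr (neg G) (Tensor X G)))"
      "realizes U P X" "G \<in> U"
  | (CoAct) a P X G where "p = (CoAct a P, Parr (MNeg a (Tensor X (neg G))) G)"
      "realizes U P X" "G \<in> U"
proof -
  obtain S X where p: "p = (S, X)" by fastforce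
  have "realizes U S X" and "threads S = {#S#}"
    using assms by (auto simp: realized_threads_def p)
  then show thesis
  proof cases
    case (realizes_Par P1 X1 P2 X2)
    have "S \<in># threads P1 \<or> S \<in># threads P2"
      using \<open>threads S = {#S#}\<close> realizes_Par(1) 
      by (metis threads.simps(2) union_iff union_single_eq_member)
    \<comment> \<open>A thread is never larger than the process containing it, so a parallel
      composition cannot be its own thread.\<close>
    moreover have "size R \<le> size P'" if "R \<in># threads P'" for R P' :: "'a mccs"
      using that by (induction P') auto
    ultimately have "size S \<le> size P1 \<or> size S \<le> size P2" by blast
    then show thesis using realizes_Par(1) by simp
  qed (use that p in auto)
qed

lemma realizes_imp_realized_threads:
  "realizes U P X \<Longrightarrow> \<exists>M. realized_threads U M \<and> image_mset fst M = threads P \<and>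
    total_size M \<le> size P \<and> (\<forall>Z. total_balance Z M = balance Z X)"
proof (induction rule: realizes.induct)
  case (realizes_One G)
  then show ?case by (intro exI[of _ "{#}"]) (simp add: realized_threads_def)
next
  case (realizes_Par P X Q Y)
  then obtain M N where
    "realized_threads U M" "image_mset fst M = threads P" "total_size M \<le> size P"
    "\<forall>Z. total_balance Z M = balance Z X"
    "realized_threads U N" "image_mset fst N = threads Q" "total_size N \<le> size Q"
    "\<forall>Z. total_balance Z N = balance Z Y"
    by blast
  then show ?case by (intro exI[of _ "M + N"]) simp
next
  case (realizes_Act P X G a)
  let ?p = "(Act a P, MPos a (Parr (neg G) (Tensor X G)))"
  show ?case
    using realizes_Act realizes.realizes_Act[of U P X G a]
    by (intro exI[of _ "{#?p#}"]) (simp add: realized_threads_def)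
next
  case (realizes_CoAct P X G a)
  let ?p = "(CoAct a P, Parr (MNeg a (Tensor X (neg G))) G)"
  show ?case
    using realizes_CoAct realizes.realizes_CoAct[of U P X G a]
    by (intro exI[of _ "{#?p#}"]) (simp add: realized_threads_def)
qed

section \<open>Signs of sums over multisets\<close>

lemma sum_mset_nonneg:
  fixes f :: "'a \<Rightarrow> 'b :: ordered_comm_monoid_add"
  shows "(\<And>x. x \<in># M \<Longrightarrow> f x \<ge> 0) \<Longrightarrow> (\<Sum>x\<in>#M. f x) \<ge> 0"
  by (induction M) (auto intro: add_nonneg_nonneg)

lemma sum_mset_neg_imp_ex:
  fixes f :: "'a \<Rightarrow> 'b :: linordered_ab_group_add"
  shows "(\<Sum>x\<in>#M. f x) < 0 \<Longrightarrow> \<exists>x\<in>#M. f x < 0"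
  using sum_mset_nonneg[of M f] by (meson not_le)

lemma sum_mset_pos_imp_ex:
  fixes f :: "'a \<Rightarrow> 'b :: linordered_ab_group_add"
  assumes "(\<Sum>x\<in>#M. f x) > 0"
  shows "\<exists>x\<in>#M. f x > 0"
proof -
  have "(\<Sum>x\<in>#M. - f x) = - (\<Sum>x\<in>#M. f x)" by (induction M) auto
  then show ?thesis using assms sum_mset_neg_imp_ex[of "\<lambda>x. - f x" M] by auto
qed

lemma sum_mset_nonneg_pos:
  fixes f :: "'a \<Rightarrow> 'b :: ordered_comm_monoid_add"
  assumes "x \<in># M" "f x > 0" "\<And>y. y \<in># M \<Longrightarrow> f y \<ge> 0"
  shows "(\<Sum>x\<in>#M. f x) > 0"
proof -
  obtain N where N: "M = add_mset x N" using assms(1) by (metis insert_DiffM)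
  have "(\<Sum>x\<in>#N. f x) \<ge> 0" using assms(3) N by (intro sum_mset_nonneg) auto
  then show ?thesis using assms(2) N by (simp add: add_pos_nonneg)
qed

text \<open>Induction on the size of the source threads: each round fires a reaction or cancels a
  common thread. The sets differ because the source is instantiated freely while the target keeps
  its variables, so the arbitrary formula in an output of \<open>N\<close> is a bare
  variable.\<close>

lemma balanced_imp_reacts_star:
  fixes M N :: "('c mccs \<times> 'c formula) multiset"
  assumes "realized_threads UNIV M" "realized_threads (range Var) N"
    and "\<And>Z. total_balance Z M = total_balance Z N"
  shows "reacts\<^sup>*\<^sup>* (image_mset fst M) (image_mset fst N)"
  using assms
proof (induction "total_size M" arbitrary: M N rule: less_induct)
  case less
  note M = less.prems(1) and N = less.prems(2) and bal = less.prems(3)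
  \<comment> \<open>Equal formulas come from equal threads. Removing the pair keeps the balance and
    shrinks the source; the reactions found for the rest run beside \<open>S\<close>.\<close>
  have cancel: ?case if SX: "(S, X) \<in># M" "(S', X) \<in># N" for S S' X
  proof -
    have S: "realizes UNIV S X" "threads S = {#S#}"
      using SX(1) M by (auto simp: realized_threads_def)
    have "realizes (range Var) S' X" using SX(2) N by (auto simp: realized_threads_def)
    with S(1) have "S = S'" by (rule realizes_inject)
    have "S \<noteq> One" using S(2) by auto
    then have "size S > 0" by (cases S) simp_all
    moreover obtain M' where M': "M = add_mset (S, X) M'"
      using SX(1) by (blast dest: multi_member_split)
    moreover obtain N' where N': "N = add_mset (S, X) N'"
      using SX(2) unfolding \<open>S = S'\<close> by (blast dest: multi_member_split)
    ultimately have "reacts\<^sup>*\<^sup>* (image_mset fst M') (image_mset fst N')"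
      using M N bal by (intro less.hyps) auto
    then show ?thesis using M' N' reacts_star_add_mset by simp
  qed
  show ?case
  proof (cases "\<exists>a P X. (CoAct a P, X) \<in># M")
    case True
    define C where "C = {p \<in> set_mset M. \<exists>a P. fst p = CoAct a P}"
    \<comment> \<open>The size of the negative atom of an output. The default 0 covers shapes that
      no element of \<open>C\<close> has.\<close>
    define atom_size :: "'c mccs \<times> 'c formula \<Rightarrow> nat" where
      "atom_size p = (case snd p of Parr A G \<Rightarrow> size A | _ \<Rightarrow> 0)" for p
    have "finite C" "C \<noteq> {}" unfolding C_def using True by force+
    then have "Max (atom_size ` C) \<in> atom_size ` C" by (intro Max_in) auto
    then obtain p where p: "p \<in> C" and "atom_size p = Max (atom_size ` C)" by force
    with \<open>finite C\<close> have max: "atom_size q \<le> atom_size p" if "q \<in> C" for q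
      using that by simp
    have "p \<in># M" and p_CoAct: "\<exists>a P. fst p = CoAct a P" using p by (auto simp: C_def)
    from M \<open>p \<in># M\<close> obtain a P X G where pM: "(CoAct a P, Parr (MNeg a (Tensor X (neg G))) G) \<in># M"
      and p_eq: "p = (CoAct a P, Parr (MNeg a (Tensor X (neg G))) G)" and P: "realizes UNIV P X"
      by (cases rule: realized_threads_cases) (use p_CoAct \<open>p \<in># M\<close> in auto)
    \<comment> \<open>The atom that occurs negatively in \<open>p\<close>, a largest one among those
      of the outputs of \<open>M\<close>.\<close>
    let ?Z = "MPos a (Parr (neg X) G)"
    show ?thesis
    proof (cases "\<exists>S. (S, ?Z) \<in># M")
      case True
      then obtain S where S: "(S, ?Z) \<in># M" by blast
      \<comment> \<open>Comparing \<open>?Z\<close> with the formula of an input forces the input's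
        variable to stand for \<open>X\<close>, hence \<open>G = Tensor Y X\<close>.\<close>
      from M S obtain Q Y where Q: "S = Act a Q" "G = Tensor Y X" "realizes UNIV Q Y"
        by (cases rule: realized_threads_cases) auto
      obtain M1 where M1: "M = add_mset p M1"
        using \<open>p \<in># M\<close> by (blast dest: multi_member_split)
      then have "(S, ?Z) \<in># M1" using S by (simp add: p_eq)
      then obtain M' where M': "M = add_mset p (add_mset (S, ?Z) M')"
        using M1 by (blast dest: multi_member_split)
      obtain MP MQ where
        R: "realized_threads UNIV MP" "image_mset fst MP = threads P" "total_size MP \<le> size P"
          "\<And>Z. total_balance Z MP = balance Z X"
          "realized_threads UNIV MQ" "image_mset fst MQ = threads Q" "total_size MQ \<le> size Q"
          "\<And>Z. total_balance Z MQ = balance Z Y"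
        using realizes_imp_realized_threads[OF P] realizes_imp_realized_threads[OF Q(3)] by blast
      have "reacts\<^sup>*\<^sup>* (image_mset fst (MP + MQ + M')) (image_mset fst N)"
      proof (rule less.hyps)
        show "total_size (MP + MQ + M') < total_size M"
          using R(3,7) by (simp add: M' p_eq Q(1))
        show "realized_threads UNIV (MP + MQ + M')" using R(1,5) M by (simp add: M' p_eq)
        \<comment> \<open>The two occurrences of \<open>?Z\<close> cancel, and what remains of
          \<open>p\<close> is \<open>G\<close>, whose balance is that of the continuations.\<close>
        show "total_balance Z (MP + MQ + M') = total_balance Z N" for Z
          using R(4,8) bal[of Z, symmetric] by (simp add: M' p_eq Q(2))
      qed (rule N)
      moreover have "reacts (image_mset fst M) (image_mset fst (MP + MQ + M'))"
        using reacts.intros[of a P Q "image_mset fst M'"] R(2,6) by (simp add: M' p_eq Q(1))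
      ultimately show ?thesis by (rule converse_rtranclp_into_rtranclp[rotated])
    next
      case False
      \<comment> \<open>No input has formula \<open>?Z\<close> here, and by maximality the arbitrary
        formula of any output is too small to contain \<open>?Z\<close>.\<close>
      have nonpos: "balance ?Z (snd q) \<le> 0" if "q \<in># M" for q
        using M that
      proof (cases rule: realized_threads_cases)
        case (Act b Q Y H)
        then show ?thesis using False that by auto
      next
        case (CoAct b Q Y H)
        have "q \<in> C" using CoAct(1) that by (auto simp: C_def)
        from max[OF this] have "size H < size ?Z"
          by (simp add: CoAct(1) p_eq atom_size_def)
        then show ?thesis by (simp add: CoAct(1) balance_eq_0)
      qed
      have "0 < (\<Sum>q\<in>#M. - balance ?Z (snd q))"
      proof (rule sum_mset_nonneg_pos)
        show "p \<in># M" by fact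
        show "- balance ?Z (snd p) > 0" by (simp add: p_eq balance_eq_0)
      qed (use nonpos in auto)
      also have "\<dots> = - total_balance ?Z M" by (induction M) auto
      finally have "total_balance ?Z N < 0" using bal by simp
      from sum_mset_neg_imp_ex[OF this] obtain q where q: "q \<in># N" "balance ?Z (snd q) < 0"
        by auto
      \<comment> \<open>Since the second half of an output of \<open>N\<close> is a variable, the
        negative \<open>?Z\<close> is its modal part. It determines both \<open>X\<close> and
        \<open>G\<close>, hence the whole formula.\<close>
      from N q(1) have "snd q = snd p"
        by (cases rule: realized_threads_cases)
          (use q(2) in \<open>auto simp: p_eq of_bool_def split: if_splits\<close>)
      then show ?thesis
        using cancel[of _ "snd p" "fst q"] \<open>p \<in># M\<close> q(1) by (metis prod.collapse)
    qed
  next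
    case False
    have M_Act: "\<exists>a A. snd r = MPos a A" if "r \<in># M" for r
      using M that by (cases rule: realized_threads_cases) (use False that in auto)
    \<comment> \<open>An output of \<open>N\<close> would contribute its variable positively;
      nothing in \<open>N\<close> compensates it, and the inputs of \<open>M\<close> have no
      variable outside modalities.\<close>
    have no_CoAct: "\<nexists>b Q Y. (CoAct b Q, Y) \<in># N"
    proof
      assume "\<exists>b Q Y. (CoAct b Q, Y) \<in># N"
      then obtain b Q Y where q: "(CoAct b Q, Y) \<in># N" by blast
      with N obtain B x where Y: "Y = Parr (MNeg b B) (Var x)"
        by (cases rule: realized_threads_cases) auto
      have "balance (Var x) (snd r) \<ge> 0" if "r \<in># N" for r
        using N that by (cases rule: realized_threads_cases) auto
      then have "0 < (\<Sum>r\<in>#N. balance (Var x) (snd r))"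
        using q by (intro sum_mset_nonneg_pos[of "(CoAct b Q, Y)"]) (auto simp: Y)
      then have "0 < total_balance (Var x) M" using bal by simp
      from sum_mset_pos_imp_ex[OF this] obtain r where r: "r \<in># M" "balance (Var x) (snd r) > 0"
        by auto
      then show False using M_Act[OF r(1)] by auto
    qed
    have N_Act: "\<exists>a A. snd r = MPos a A" if "r \<in># N" for r
      using N that by (cases rule: realized_threads_cases) (use no_CoAct that in auto)
    \<comment> \<open>Only inputs are left, so every formula is a positive atom. By balance, the
      atom of a thread on either side occurs on both, and a pair can be cancelled.\<close>
    have shared: ?thesis if q: "q \<in># M + N" for q
    proof -
      let ?Z = "snd q"
      have Z: "balance ?Z ?Z > 0" using M_Act N_Act q by fastforce
      have nonneg: "balance ?Z (snd r) \<ge> 0" if "r \<in># M + N" for r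
        using M_Act N_Act that by fastforce
      have pos: "0 < (\<Sum>r\<in>#K. balance ?Z (snd r))" if "q \<in># K" "K \<subseteq># M + N" for K
        using that(1) Z nonneg mset_subset_eqD[OF that(2)] by (intro sum_mset_nonneg_pos) auto
      have "0 < total_balance ?Z M"
      proof (cases "q \<in># M")
        case True
        then show ?thesis using pos[of M] by simp
      next
        case False
        then have "0 < total_balance ?Z N" using q pos[of N] by simp
        then show ?thesis using bal by simp
      qed
      moreover from this have "0 < total_balance ?Z N" using bal by simp
      ultimately obtain r r' where r: "r \<in># M" "balance ?Z (snd r) > 0"
        and r': "r' \<in># N" "balance ?Z (snd r') > 0"
        by (auto dest!: sum_mset_pos_imp_ex)
      have "snd r = ?Z" "snd r' = ?Z" using M_Act[OF r(1)] N_Act[OF r'(1)] r(2) r'(2)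
        by (auto simp: of_bool_def split: if_splits)
      then show ?thesis
        using cancel[of "fst r" ?Z "fst r'"] r(1) r'(1) by (metis prod.collapse)
    qed
    show ?thesis
    proof (cases "M + N = {#}")
      case False
      then show ?thesis using shared by (meson multiset_nonemptyE)
    qed simp
  qed
qed

theorem theorem10:
  fixes P Q :: "'c mccs" and A B :: "'c formula"
  assumes "translates P A" and "translates Q B" and "vars A \<inter> vars B = {}"
  shows "P \<leadsto>* Q \<longleftrightarrow>
    (\<exists>F. (\<forall>x. x \<notin> vars A \<longrightarrow> F x = Var x) \<and> mll {#inst F (A \<multimap> B)#})"
proof
  assume "P \<leadsto>* Q"
  then have "simulates P Q" by (rule exec_simulates)
  moreover have "realizes UNIV Q B" using translates_imp_realizes[OF assms(2), of Var] by simp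
  ultimately obtain X where X: "realizes UNIV P X" "entails X B"
    unfolding simulates_def by blast
  then obtain F where F: "inst F A = X" using realizes_imp_inst assms(1) by blast
  \<comment> \<open>Resetting \<open>F\<close> outside \<open>vars A\<close> leaves \<open>B\<close>
    unchanged, because the variables of \<open>A\<close> and \<open>B\<close> are disjoint.\<close>
  let ?F = "\<lambda>x. if x \<in> vars A then F x else Var x"
  have "inst ?F A = X" unfolding F[symmetric] by (intro inst_cong) simp
  moreover have "inst ?F B = inst Var B" using assms(3) by (intro inst_cong) auto
  ultimately have "inst ?F (A \<multimap> B) = Parr (neg X) B" by (simp add: limp_def inst_neg)
  then have "mll {#inst ?F (A \<multimap> B)#}" using X(2) mll_parr by (simp add: entails_def)
  then show "\<exists>F. (\<forall>x. x \<notin> vars A \<longrightarrow> F x = Var x) \<and> mll {#inst F (A \<multimap> B)#}"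
    by (intro exI[of _ ?F]) simp
next
  assume "\<exists>F. (\<forall>x. x \<notin> vars A \<longrightarrow> F x = Var x) \<and> mll {#inst F (A \<multimap> B)#}"
  then obtain F where F: "\<And>x. x \<notin> vars A \<Longrightarrow> F x = Var x" "mll {#inst F (A \<multimap> B)#}"
    by blast
  have "inst F B = inst Var B" using assms(3) F(1) by (intro inst_cong) auto
  \<comment> \<open>The balance of the provable implication is zero, and it is the balance of
    \<open>B\<close> minus that of the instance of \<open>A\<close>.\<close>
  then have bal: "balance Z (inst F A) = balance Z B" for Z
    using mll_balance[OF F(2), of Z] by (simp add: limp_def inst_neg)
  obtain M where M: "realized_threads UNIV M" "image_mset fst M = threads P"
    "\<And>Z. total_balance Z M = balance Z (inst F A)"
    using realizes_imp_realized_threads[OF translates_imp_realizes[OF assms(1), of F UNIV]]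
    by blast
  have "realizes (range Var) Q B"
    using translates_imp_realizes[OF assms(2), of Var "range Var"] by simp
  then obtain N where N: "realized_threads (range Var) N" "image_mset fst N = threads Q"
    "\<And>Z. total_balance Z N = balance Z B"
    using realizes_imp_realized_threads by blast
  have "reacts\<^sup>*\<^sup>* (threads P) (threads Q)"
    using balanced_imp_reacts_star[OF M(1) N(1)] M(2,3) N(2,3) bal by simp
  then show "P \<leadsto>* Q" using reacts_star_imp_exec by blast
qed

end
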